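(* Let $\lambda=(n-1,1)$ and fix $\varepsilon>0$. If $f$ is generated by the random model $R(K,\mathcal C)$ with $K\le(1-\varepsilon)n\log n$, then with probability $1-o(1)$ as $n\to\infty$ the sparsest-fit algorithm applied to $\hat f(\lambda)$ recovers $f$.
   Context: $\log$ is the natural logarithm. $S_n$ is the symmetric group on $\{1,\dots,n\}$. For a partition $\lambda=(\lambda_1,\dots,\lambda_r)$ of $n$ ($\lambda_1\ge\dots\ge\lambda_r\ge1$), a $\lambda$-partition of $\{1,\dots,n\}$ is an ordered tuple $(B_1,\dots,B_r)$ of disjoint sets with $|B_i|=\lambda_i$ and union $\{1,\dots,n\}$; there are $D_\lambda=n!/\prod_i\lambda_i!$ of them, enumerated $t_1,\dots,t_{D_\lambda}$; $\sigma$ acts by $\sigma(B_1,\dots,B_r)=(\sigma(B_1),\dots,\sigma(B_r))$. $M^\lambda(\sigma)$ is the $D_\lambda\times D_\lambda$ $0/1$ matrix with $M^\lambda_{ij}(\sigma)=1$ iff $\sigma(t_j)=t_i$, and $\hat f(\lambda)=\sum_\sigma f(\sigma)M^\lambda(\sigma)$. (For $\lambda=(n-1,1)$, $\hat f(\lambda)_{ij}=\sum_{k:\sigma_k(j)=i}f(\sigma_k)$.) Random model $R(K,\mathcal C)$: for fixed $\mathcal C=[a,b]$, $0<a<b$, choose $\sigma_1,\dots,\sigma_K$ i.i.d. uniform from $S_n$ (with replacement) and $p_1,\dots,p_K$ i.i.d. uniform on $\mathcal C$; $f(\sigma)=p_i$ if $\sigma=\sigma_i$, else $0$. Sparsest-fit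 algorithm: input the nonzero entries $q_1\le\dots\le q_L$ of $\hat f(\lambda)$ sorted ascending (with their matrix positions). Initialize $p_0=0$, $k(0)=0$, all $A_k=\emptyset$. For $\ell=1,\dots,L$: if $q_\ell=\sum_{k\in T}p_k$ for some $T\subseteq\{0,\dots,k(\ell-1)\}$, set $k(\ell)=k(\ell-1)$ and add $\ell$ to $A_k$ for $k\in T$; else set $k(\ell)=k(\ell-1)+1$, $p_{k(\ell)}=q_\ell$, add $\ell$ to $A_{k(\ell)}$. Output $(p_k,A_k)_{1\le k\le k(L)}$; each $A_k$ (a set of matrix positions) is read as the support of $M^\lambda(\sigma_k)$, giving a permutation $\sigma_k$ with value $p_k$. "Recovers $f$" means the resulting function equals $f$. *)

theory Defs
  imports "HOL-Probability.Probability" "HOL-Combinatorics.Permutations"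
begin

definition perms :: "nat \<Rightarrow> (nat \<Rightarrow> nat) set" where
  "perms n = {\<sigma>. \<sigma> permutes {1..n}}"

text \<open>For lambda = (n-1,1) the lambda-partitions are (B_1,{j}) and are identified with j in {1..n}.
  Then M(sigma)_{ij} = 1 iff sigma(j) = i, so fhat(lambda)_{ij} = sum of f(sigma) over sigma with sigma j = i.
  Matrix entries are indexed by (i,j) in {1..n} x {1..n}.\<close>
definition fhat :: "nat \<Rightarrow> ((nat \<Rightarrow> nat) \<Rightarrow> real) \<Rightarrow> nat \<Rightarrow> nat \<Rightarrow> real" where
  "fhat n f i j = (\<Sum>\<sigma>\<in>perms n. if \<sigma> j = i then f \<sigma> else 0)"

definition rm_space :: "nat \<Rightarrow> nat \<Rightarrow> real \<Rightarrow> real \<Rightarrow> ((nat \<Rightarrow> (nat \<Rightarrow> nat)) \<times> (nat \<Rightarrow> real)) measure" where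
  "rm_space n K a b =
     (PiM {..<K} (\<lambda>_. measure_pmf (pmf_of_set (perms n))))
     \<Otimes>\<^sub>M (PiM {..<K} (\<lambda>_. uniform_measure lborel {a..b}))"

definition rm_f :: "nat \<Rightarrow> ((nat \<Rightarrow> (nat \<Rightarrow> nat)) \<times> (nat \<Rightarrow> real)) \<Rightarrow> (nat \<Rightarrow> nat) \<Rightarrow> real" where
  "rm_f K \<omega> \<sigma> = (if \<exists>i<K. fst \<omega> i = \<sigma> then snd \<omega> (LEAST i. i < K \<and> fst \<omega> i = \<sigma>) else 0)"

definition sf_input :: "nat \<Rightarrow> (nat \<Rightarrow> nat \<Rightarrow> real) \<Rightarrow> ((nat \<times> nat) \<times> real) list \<Rightarrow> bool" where
  "sf_input n F xs \<longleftrightarrow>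
     distinct (map fst xs) \<and>
     set (map fst xs) = {(i, j). i \<in> {1..n} \<and> j \<in> {1..n} \<and> F i j \<noteq> 0} \<and>
     (\<forall>((i, j), q) \<in> set xs. q = F i j) \<and>
     sorted (map snd xs)"

text \<open>Execution of the algorithm. The state is the list [p_1,...,p_k] and the list [A_1,...,A_k]
  (A_k a set of matrix positions). The dummy p_0 = 0 / A_0 is omitted: it contributes nothing to
  subset sums and A_0 is not part of the output. The relation is nondeterministic in the choice of T.
  sf_run xs ps As ps' As' : starting in state (ps, As), processing xs can end in (ps', As').\<close>
inductive sf_run :: "((nat \<times> nat) \<times> real) list \<Rightarrow> real list \<Rightarrow> (nat \<times> nat) set list
                      \<Rightarrow> real list \<Rightarrow> (nat \<times> nat) set list \<Rightarrow> bool" where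
  sf_done: "sf_run [] ps As ps As"
| sf_old: "T \<subseteq> {..<length ps} \<Longrightarrow> q = (\<Sum>k\<in>T. ps ! k) \<Longrightarrow>
      sf_run rest ps (map (\<lambda>k. if k \<in> T then insert pos (As ! k) else As ! k) [0..<length As]) ps' As' \<Longrightarrow>
      sf_run ((pos, q) # rest) ps As ps' As'"
| sf_new: "\<not> (\<exists>T \<subseteq> {..<length ps}. q = (\<Sum>k\<in>T. ps ! k)) \<Longrightarrow>
      sf_run rest (ps @ [q]) (As @ [{pos}]) ps' As' \<Longrightarrow>
      sf_run ((pos, q) # rest) ps As ps' As'"

definition recovers :: "nat \<Rightarrow> ((nat \<Rightarrow> nat) \<Rightarrow> real) \<Rightarrow> real list \<Rightarrow> (nat \<times> nat) set list \<Rightarrow> bool" where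
  "recovers n f ps As \<longleftrightarrow>
     length As = length ps \<and>
     (\<exists>\<sigma>s :: nat \<Rightarrow> (nat \<Rightarrow> nat).
        (\<forall>k < length ps. \<sigma>s k \<in> perms n \<and> As ! k = {(\<sigma>s k j, j) | j. j \<in> {1..n}}) \<and>
        inj_on \<sigma>s {..<length ps} \<and>
        (\<forall>\<sigma> \<in> perms n. f \<sigma> = (\<Sum>k<length ps. if \<sigma>s k = \<sigma> then ps ! k else 0)))"

definition sparsest_fit_recovers :: "nat \<Rightarrow> ((nat \<Rightarrow> nat) \<Rightarrow> real) \<Rightarrow> bool" where
  "sparsest_fit_recovers n f \<longleftrightarrow>
     (\<forall>xs ps As. sf_input n (fhat n f) xs \<and> sf_run xs [] [] ps As \<longrightarrow> recovers n f ps As)"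

end

theory Submission
  imports Defs "HOL-Real_Asymp.Real_Asymp"
begin

text \<open>If the subset sums of the values \<open>p k\<close> are pairwise distinct and every permutation \<open>s k\<close> has a
  witness column, i.e. a column \<open>j\<close> on which no other \<open>s k'\<close> agrees with it, then every value occurs
  as a matrix entry, and it is read before every larger sum containing it; hence the algorithm
  is correct. Subset sums are almost surely distinct. For a fixed \<open>k\<close>, reveal the first
  \<open>L \<approx> e n\<close> columns one after the other: given the past, each column is a witness with probability
  at least \<open>(1 - 1 / (n - L)) ^ (K - 1) \<ge> n powr (e - 1)\<close>, so all of them fail with probability
  at most \<open>exp (- (e n - 1) n powr (e - 1))\<close>, and a union bound over the \<open>K = O(n ln n)\<close> choices
  of \<open>k\<close> suffices. As \<open>measure\<close> is zero on non-measurable sets, the success event must also be shown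
  to be measurable.\<close>

section \<open>Correctness of the algorithm\<close>

lemma sum_nth_map:
  fixes p :: "'k \<Rightarrow> real"
  assumes "distinct ks" "T \<subseteq> {..<length ks}"
  shows "(\<Sum>k\<in>T. map p ks ! k) = sum p ((!) ks ` T)"
proof -
  have "inj_on ((!) ks) T"
    using assms by (auto simp: inj_on_def nth_eq_iff_index_eq subset_iff)
  then have "sum p ((!) ks ` T) = (\<Sum>k\<in>T. p (ks ! k))"
    by (simp add: sum.reindex)
  also have "\<dots> = (\<Sum>k\<in>T. map p ks ! k)"
    using assms(2) by (intro sum.cong) auto
  finally show ?thesis by simp
qed

text \<open>The algorithm compares numbers only. Injectivity of \<open>sum p\<close> on
  \<open>Pow I\<close> turns a match of values into a match of index sets, so a subset-sum test
  never succeeds by coincidence.\<close>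

lemma subset_sum_list_iff:
  fixes p :: "'k \<Rightarrow> real"
  assumes inj: "inj_on (sum p) (Pow I)" and "distinct ks" "set ks \<subseteq> I" "A \<subseteq> I"
    and "T \<subseteq> {..<length ks}"
  shows "sum p A = (\<Sum>k\<in>T. map p ks ! k) \<longleftrightarrow> A = (!) ks ` T"
proof -
  have "(!) ks ` T \<subseteq> I"
    using assms by (auto dest!: subsetD[where A=T])
  then show ?thesis
    unfolding sum_nth_map[OF assms(2,5)]
    using inj_onD[OF inj, of A "(!) ks ` T"] assms(4) by auto
qed

text \<open>Here \<open>S x\<close> is the set of permutations contributing to the matrix entry at position \<open>x\<close>
  and \<open>D\<close> the set of positions processed so far. If some \<open>k \<in> S x\<close> has not been discovered yet,
  then its witness entry, of value \<open>p k\<close>, is still to come; so \<open>sum p (S x) \<le> p k\<close> and \<open>S x = {k}\<close>.\<close>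

lemma sf_run_invariant:
  fixes p :: "'k \<Rightarrow> real" and S :: "nat \<times> nat \<Rightarrow> 'k set"
  assumes "sf_run xs ps As ps' As'"
    and fin: "finite I" and pos: "\<And>k. k \<in> I \<Longrightarrow> p k > 0" and inj: "inj_on (sum p) (Pow I)"
    and SI: "\<And>x. S x \<subseteq> I"
    and "distinct ks" "set ks \<subseteq> I" "ps = map p ks" "As = map (\<lambda>k. {x\<in>D. k \<in> S x}) ks"
    and "\<forall>x\<in>D. S x \<subseteq> set ks" "\<forall>(x, q)\<in>set xs. q = sum p (S x)" "sorted (map snd xs)"
    and "\<forall>k\<in>I. \<exists>x\<in>D \<union> fst ` set xs. S x = {k}"
  shows "\<exists>ks'. distinct ks' \<and> set ks' \<subseteq> I \<and> ps' = map p ks' \<and>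
           As' = map (\<lambda>k. {x\<in>D \<union> fst ` set xs. k \<in> S x}) ks' \<and>
           (\<forall>x\<in>D \<union> fst ` set xs. S x \<subseteq> set ks')"
  using assms(1) assms(6-)
proof (induction arbitrary: ks D rule: sf_run.induct)
  case (sf_done ps As)
  then show ?case by auto
next
  case (sf_old T ps q rest x As ps' As')
  have q: "q = sum p (S x)" using sf_old.prems(6) by auto
  have T: "T \<subseteq> {..<length ks}" using sf_old.hyps(1) sf_old.prems(3) by simp
  \<comment> \<open>Whatever \<open>T\<close> the nondeterministic step picks, it must index exactly
    the contributors of \<open>x\<close>.\<close>
  have eq: "S x = (!) ks ` T"
    using subset_sum_list_iff[OF inj sf_old.prems(1,2) SI[of x] T] q sf_old.hyps sf_old.prems(3) by auto
  have upd: "map (\<lambda>k. if k \<in> T then insert x (As ! k) else As ! k) [0..<length As]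
       = map (\<lambda>k. {y\<in>insert x D. k \<in> S y}) ks"
  proof (rule nth_equalityI)
    fix i assume i: "i < length (map (\<lambda>k. if k \<in> T then insert x (As ! k) else As ! k) [0..<length As])"
    then have i': "i < length ks" using sf_old.prems(4) by simp
    have "i \<in> T \<longleftrightarrow> ks ! i \<in> S x"
      unfolding eq using T i' sf_old.prems(1) by (auto simp: nth_eq_iff_index_eq image_iff subset_iff)
    then show "map (\<lambda>k. if k \<in> T then insert x (As ! k) else As ! k) [0..<length As] ! i
       = map (\<lambda>k. {y\<in>insert x D. k \<in> S y}) ks ! i"
      using i i' sf_old.prems(4) by auto
  qed (use sf_old.prems(4) in simp)
  have sub: "S x \<subseteq> set ks" using eq T by (auto dest!: subsetD[where A=T])
  have "\<exists>ks'. distinct ks' \<and> set ks' \<subseteq> I \<and> ps' = map p ks' \<and>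
           As' = map (\<lambda>k. {y\<in>insert x D \<union> fst ` set rest. k \<in> S y}) ks' \<and>
           (\<forall>y\<in>insert x D \<union> fst ` set rest. S y \<subseteq> set ks')"
  proof (rule sf_old.IH)
    show "\<forall>k\<in>I. \<exists>y\<in>insert x D \<union> fst ` set rest. S y = {k}"
      using sf_old.prems(8) by auto
    show "\<forall>y\<in>insert x D. S y \<subseteq> set ks" using sf_old.prems(5) sub by auto
  qed (use sf_old.prems(1-3,6,7) upd in auto)
  then show ?case by simp
next
  case (sf_new ps q rest As x ps' As')
  have q: "q = sum p (S x)" using sf_new.prems(6) by auto
  have nsub: "\<not> S x \<subseteq> set ks"
  proof
    assume "S x \<subseteq> set ks"
    \<comment> \<open>If all contributors were known already, their places in \<open>ks\<close>
      would form a set refuting the test that led to \<open>sf_new\<close>.\<close>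
    define T where "T = {i. i < length ks \<and> ks ! i \<in> S x}"
    have "S x = (!) ks ` T"
      using \<open>S x \<subseteq> set ks\<close> by (force simp: T_def in_set_conv_nth image_iff subset_iff)
    moreover have "T \<subseteq> {..<length ks}" by (auto simp: T_def)
    ultimately show False
      using subset_sum_list_iff[OF inj sf_new.prems(1,2) SI[of x], of T] q sf_new.hyps sf_new.prems(3) by auto
  qed
  then obtain k where k: "k \<in> S x" "k \<notin> set ks" by auto
  have kI: "k \<in> I" using k SI by blast
  obtain w where w: "w \<in> D \<union> fst ` set ((x, q) # rest)" "S w = {k}"
    using bspec[OF sf_new.prems(8) kI] by (rule bexE)
  \<comment> \<open>Processed positions have all their contributors in \<open>ks\<close>, and
    \<open>k\<close> is not there; so the witness position is \<open>x\<close> itself or is still to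
    come.\<close>
  have "w \<notin> D" using w k bspec[OF sf_new.prems(5), of w] by auto
  have Sx: "S x = {k}"
  proof (cases "w = x")
    case False
    then obtain r where r: "(w, r) \<in> set rest" using w \<open>w \<notin> D\<close> by auto
    have "r = sum p (S w)" using r sf_new.prems(6) by auto
    moreover have "q \<le> r" using sf_new.prems(7) r by force
    ultimately have le: "sum p (S x) \<le> p k" using q w by simp
    have finS: "finite (S x)" using SI fin finite_subset by blast
    have "sum p (S x) = p k + sum p (S x - {k})" using finS k by (simp add: sum.remove)
    with le have "sum p (S x - {k}) \<le> 0" by simp
    moreover have "sum p (S x - {k}) > 0" if "S x - {k} \<noteq> {}"
      using that finS SI[of x] by (intro sum_pos pos) auto
    ultimately show ?thesis using k by force
  qed (use w in simp)
  have new: "As @ [{x}] = map (\<lambda>k. {y\<in>insert x D. k \<in> S y}) (ks @ [k])"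
  proof -
    have "{y \<in> insert x D. k' \<in> S y} = {y \<in> D. k' \<in> S y}" if "k' \<in> set ks" for k'
      using Sx k that by auto
    \<comment> \<open>No earlier position involves \<open>k\<close>, so nothing is lost by starting
      its set as \<open>{x}\<close>.\<close>
    moreover have "{y \<in> insert x D. k \<in> S y} = {x}"
      using Sx k sf_new.prems(5) by auto
    ultimately show ?thesis using sf_new.prems(4) by simp
  qed
  have "\<exists>ks'. distinct ks' \<and> set ks' \<subseteq> I \<and> ps' = map p ks' \<and>
           As' = map (\<lambda>k. {y\<in>insert x D \<union> fst ` set rest. k \<in> S y}) ks' \<and>
           (\<forall>y\<in>insert x D \<union> fst ` set rest. S y \<subseteq> set ks')"
  proof (rule sf_new.IH[of "ks @ [k]"])
    show "\<forall>k\<in>I. \<exists>y\<in>insert x D \<union> fst ` set rest. S y = {k}"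
      using sf_new.prems(8) by auto
    show "\<forall>y\<in>insert x D. S y \<subseteq> set (ks @ [k])"
      using sf_new.prems(5) Sx by auto
  qed (use sf_new.prems(1-4,6,7) new Sx k kI q in auto)
  then show ?case by simp
qed

section \<open>The random function and its recovery from witness columns\<close>

lemma finite_perms: "finite (perms n)"
  unfolding perms_def by (rule finite_permutations) auto

lemma card_perms: "card (perms n) = fact n"
  unfolding perms_def by (rule card_permutations) auto

text \<open>At most one summand is nonzero, the one at the first index where \<sigma> is drawn. This
  form serves the measurability proof and, for pairwise distinct permutations, the computation of
  \<open>fhat\<close>.\<close>

lemma rm_f_eq_sum:
  "rm_f K \<omega> \<sigma> = (\<Sum>i<K. if fst \<omega> i = \<sigma> \<and> (\<forall>j<i. fst \<omega> j \<noteq> \<sigma>) then snd \<omega> i else 0)"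
proof (cases "\<exists>i<K. fst \<omega> i = \<sigma>")
  case True
  define m where "m = (LEAST i. i < K \<and> fst \<omega> i = \<sigma>)"
  have m: "m < K \<and> fst \<omega> m = \<sigma>" unfolding m_def by (rule LeastI_ex[OF True])
  have least: "m \<le> i" if "i < K" "fst \<omega> i = \<sigma>" for i
    unfolding m_def using that by (intro Least_le) auto
  have "(\<Sum>i<K. if fst \<omega> i = \<sigma> \<and> (\<forall>j<i. fst \<omega> j \<noteq> \<sigma>) then snd \<omega> i else 0)
      = (\<Sum>i<K. if i = m then snd \<omega> i else 0)"
  proof (intro sum.cong if_cong refl)
    fix i assume "i \<in> {..<K}"
    have "fst \<omega> j \<noteq> \<sigma>" if "j < m" for j using least[of j] m that by auto
    then show "(fst \<omega> i = \<sigma> \<and> (\<forall>j<i. fst \<omega> j \<noteq> \<sigma>)) = (i = m)"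
      using m least[of i] \<open>i \<in> {..<K}\<close> by (cases i m rule: linorder_cases) auto
  qed
  also have "\<dots> = snd \<omega> m" using m by simp
  also have "\<dots> = rm_f K \<omega> \<sigma>" unfolding rm_f_def m_def using True by simp
  finally show ?thesis by simp
qed (auto simp: rm_f_def)

lemma rm_f_eq_sum_inj:
  assumes "inj_on (fst \<omega>) {..<K}"
  shows "rm_f K \<omega> \<sigma> = (\<Sum>i<K. if fst \<omega> i = \<sigma> then snd \<omega> i else 0)"
  unfolding rm_f_eq_sum
proof (intro sum.cong refl if_cong)
  fix i assume "i \<in> {..<K}"
  then show "(fst \<omega> i = \<sigma> \<and> (\<forall>j<i. fst \<omega> j \<noteq> \<sigma>)) = (fst \<omega> i = \<sigma>)"
    using inj_onD[OF assms, of _ i] by force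
qed

text \<open>A permutation drawn twice has no witness, so this condition also takes care of
  collisions in the sampling with replacement.\<close>

definition has_witnesses :: "nat \<Rightarrow> nat \<Rightarrow> (nat \<Rightarrow> nat \<Rightarrow> nat) \<Rightarrow> bool" where
  "has_witnesses n K s \<longleftrightarrow> (\<forall>k<K. \<exists>j\<in>{1..n}. \<forall>k'<K. k' \<noteq> k \<longrightarrow> s k' j \<noteq> s k j)"

text \<open>The matrix entry at \<open>x\<close> is \<open>sum p (S x)\<close>, where
  \<open>S x\<close> collects the indices whose permutation matrix has a one at \<open>x\<close>. So
  the invariant applies from the empty state, and the witness columns supply the singleton positions
  it asks for.\<close>

lemma sparsest_fit_recovers_rm_f:
  assumes s: "\<And>k. k < K \<Longrightarrow> s k \<in> perms n" and wit: "has_witnesses n K s"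
    and pos: "\<And>k. k < K \<Longrightarrow> p k > 0" and inj: "inj_on (sum p) (Pow {..<K})"
  shows "sparsest_fit_recovers n (rm_f K (s, p))"
  unfolding sparsest_fit_recovers_def
proof (intro allI impI, elim conjE)
  fix xs ps As
  assume input: "sf_input n (fhat n (rm_f K (s, p))) xs" and run: "sf_run xs [] [] ps As"
  define S where "S = (\<lambda>x. {k. k < K \<and> s k (snd x) = fst x})"
  have SI: "S x \<subseteq> {..<K}" for x by (auto simp: S_def)
  have injs: "inj_on s {..<K}"
    using wit unfolding has_witnesses_def inj_on_def by (metis lessThan_iff)
  have f: "rm_f K (s, p) \<sigma> = (\<Sum>i<K. if s i = \<sigma> then p i else 0)" for \<sigma>
    using rm_f_eq_sum_inj[of "(s, p)" K \<sigma>] injs unfolding fst_conv snd_conv .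
  have fh: "fhat n (rm_f K (s, p)) i j = sum p (S (i, j))" for i j
  proof -
    have "fhat n (rm_f K (s, p)) i j
        = (\<Sum>\<sigma>\<in>perms n. \<Sum>k<K. if \<sigma> j = i \<and> s k = \<sigma> then p k else 0)"
      unfolding fhat_def f by (intro sum.cong refl) auto
    also have "\<dots> = (\<Sum>k<K. \<Sum>\<sigma>\<in>perms n. if \<sigma> j = i \<and> s k = \<sigma> then p k else 0)"
      by (rule sum.swap)
    also have "\<dots> = (\<Sum>k<K. if s k j = i then p k else 0)"
    proof (intro sum.cong refl)
      fix k assume "k \<in> {..<K}"
      have "(\<Sum>\<sigma>\<in>perms n. if \<sigma> j = i \<and> s k = \<sigma> then p k else 0)
          = (\<Sum>\<sigma>\<in>perms n. if \<sigma> = s k then (if s k j = i then p k else 0) else 0)"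
        by (intro sum.cong refl) auto
      also have "\<dots> = (if s k j = i then p k else 0)"
        using s \<open>k \<in> {..<K}\<close> by (simp add: finite_perms)
      finally show "(\<Sum>\<sigma>\<in>perms n. if \<sigma> j = i \<and> s k = \<sigma> then p k else 0)
          = (if s k j = i then p k else 0)" .
    qed
    also have "\<dots> = sum p (S (i, j))"
      by (simp add: S_def sum.inter_filter[symmetric])
    finally show ?thesis .
  qed
  have positions: "fst ` set xs = {(i, j). i \<in> {1..n} \<and> j \<in> {1..n} \<and> S (i, j) \<noteq> {}}"
  proof -
    \<comment> \<open>Positive summands cannot cancel, so no position with a contributor is missing
      from the input.\<close>
    have "sum p (S x) \<noteq> 0 \<longleftrightarrow> S x \<noteq> {}" for x
    proof
      assume "S x \<noteq> {}"
      then have "sum p (S x) > 0"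
        by (intro sum_pos) (auto simp: S_def intro!: pos)
      then show "sum p (S x) \<noteq> 0" by simp
    qed auto
    then show ?thesis using input unfolding sf_input_def fh by auto
  qed
  have srange: "s k j \<in> {1..n}" if "k < K" "j \<in> {1..n}" for k j
    using s[OF that(1)] that(2) unfolding perms_def by (simp only: mem_Collect_eq permutes_in_image)
  have "\<exists>ks'. distinct ks' \<and> set ks' \<subseteq> {..<K} \<and> ps = map p ks' \<and>
           As = map (\<lambda>k. {x\<in>{} \<union> fst ` set xs. k \<in> S x}) ks' \<and>
           (\<forall>x\<in>{} \<union> fst ` set xs. S x \<subseteq> set ks')"
  proof (rule sf_run_invariant[OF run, where ks = "[]" and D = "{}"])
    show "\<forall>(x, q)\<in>set xs. q = sum p (S x)" "sorted (map snd xs)"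
      using input unfolding sf_input_def fh by auto
    show "\<forall>k\<in>{..<K}. \<exists>x\<in>{} \<union> fst ` set xs. S x = {k}"
    proof
      fix k assume k: "k \<in> {..<K}"
      then obtain j where j: "j \<in> {1..n}" "\<forall>k'<K. k' \<noteq> k \<longrightarrow> s k' j \<noteq> s k j"
        using wit unfolding has_witnesses_def by blast
      then have "S (s k j, j) = {k}" using k by (auto simp: S_def)
      moreover have "(s k j, j) \<in> fst ` set xs"
        unfolding positions using calculation j k srange by auto
      ultimately show "\<exists>x\<in>{} \<union> fst ` set xs. S x = {k}" by blast
    qed
  qed (use SI inj pos in auto)
  then obtain ks where ks: "distinct ks" "set ks \<subseteq> {..<K}" "ps = map p ks"
      "As = map (\<lambda>k. {x\<in>fst ` set xs. k \<in> S x}) ks" "\<And>x. x \<in> fst ` set xs \<Longrightarrow> S x \<subseteq> set ks"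
    unfolding Un_empty_left by blast
  \<comment> \<open>Any column \<open>j\<close> gives a processed position \<open>(s k j, j)\<close>
    to which \<open>k\<close> contributes, so \<open>k\<close> has been discovered; the witness
    provides such a column.\<close>
  have setks: "set ks = {..<K}"
  proof (intro equalityI ks(2) subsetI)
    fix k assume k: "k \<in> {..<K}"
    then obtain j where j: "j \<in> {1..n}" using wit unfolding has_witnesses_def by blast
    have "k \<in> S (s k j, j)" using k by (auto simp: S_def)
    then show "k \<in> set ks" using ks(5)[of "(s k j, j)"] j k srange unfolding positions by auto
  qed
  show "recovers n (rm_f K (s, p)) ps As"
    unfolding recovers_def
  \<comment> \<open>\<open>ks\<close> translates the numbering of the algorithm into that of the
    model.\<close>
  proof (intro conjI exI[of _ "\<lambda>m. s (ks ! m)"] allI impI ballI)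
    fix m assume "m < length ps"
    then have m: "m < length ks" "ks ! m < K" using ks setks nth_mem by fastforce+
    show "s (ks ! m) \<in> perms n" using m s by simp
    show "As ! m = {(s (ks ! m) j, j) |j. j \<in> {1..n}}"
    proof -
      have "As ! m = {x \<in> fst ` set xs. ks ! m \<in> S x}" using m ks(4) by simp
      moreover have "x \<in> fst ` set xs \<and> ks ! m \<in> S x \<longleftrightarrow> (\<exists>j\<in>{1..n}. x = (s (ks ! m) j, j))" for x
        unfolding positions using m(2) srange[OF m(2), of "snd x"] by (cases x) (force simp: S_def)
      ultimately show ?thesis by blast
    qed
  next
    show "inj_on (\<lambda>m. s (ks ! m)) {..<length ps}"
    proof (rule inj_onI)
      fix x y assume "x \<in> {..<length ps}" "y \<in> {..<length ps}" "s (ks ! x) = s (ks ! y)"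
      moreover from this have "ks ! x \<in> {..<K}" "ks ! y \<in> {..<K}"
        using ks(3) nth_mem unfolding setks[symmetric] by auto
      ultimately have "ks ! x = ks ! y" using inj_onD[OF injs] by blast
      with \<open>x \<in> _\<close> \<open>y \<in> _\<close> show "x = y" using ks(1,3) by (simp add: nth_eq_iff_index_eq)
    qed
  next
    fix \<sigma>
    have "(\<Sum>k<length ps. if s (ks ! k) = \<sigma> then ps ! k else 0)
        = (\<Sum>k<length ks. (\<lambda>k. if s k = \<sigma> then p k else 0) (ks ! k))"
      using ks(3) by (intro sum.cong) auto
    also have "\<dots> = (\<Sum>k\<in>set ks. if s k = \<sigma> then p k else 0)"
      using ks(1) bij_betw_nth[of ks "{..<length ks}" "set ks"] by (intro sum.reindex_bij_betw) auto
    also have "\<dots> = rm_f K (s, p) \<sigma>" unfolding f setks ..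
    finally show "rm_f K (s, p) \<sigma> = (\<Sum>k<length ps. if s (ks ! k) = \<sigma> then ps ! k else 0)" by simp
  qed (use ks in auto)
qed

section \<open>Tuples of permutations without a witness\<close>

text \<open>Fixing a prefix of columns lets the failure probability be bounded one column at a time.
  The tuples are extensional, which makes the set finite and lets counting replace
  probability.\<close>

definition covered :: "nat \<Rightarrow> nat \<Rightarrow> nat \<Rightarrow> nat \<Rightarrow> (nat \<Rightarrow> nat \<Rightarrow> nat) set" where
  "covered n K i L = {s \<in> {..<K} \<rightarrow>\<^sub>E perms n. \<forall>l\<in>{1..L}. \<exists>k<K. k \<noteq> i \<and> s k l = s i l}"

lemma finite_covered: "finite (covered n K i L)"
  unfolding covered_def by (intro finite_subset[OF _ finite_PiE[of "{..<K}" "\<lambda>_. perms n"]]) (auto simp: finite_perms)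

text \<open>Precomposition with the transposition moves the entry of \<open>s k\<close> in column
  \<open>y k\<close> to column \<open>l\<close>. With \<open>y k\<close> uniform on the columns from
  \<open>l\<close> on, this re-draws column \<open>l\<close> given the earlier ones;
  \<open>s i\<close> is the reference and stays fixed.\<close>

definition shuffle :: "nat \<Rightarrow> nat \<Rightarrow> nat \<Rightarrow> (nat \<Rightarrow> nat) \<Rightarrow> (nat \<Rightarrow> nat \<Rightarrow> nat) \<Rightarrow> nat \<Rightarrow> nat \<Rightarrow> nat" where
  "shuffle K i l y s = (\<lambda>k\<in>{..<K}. if k = i then s i else s k \<circ> Transposition.transpose l (y k))"

lemma shuffle_PiE:
  assumes "s \<in> {..<K} \<rightarrow>\<^sub>E perms n" "y \<in> ({..<K} - {i}) \<rightarrow>\<^sub>E {Suc L..n}" "Suc L \<le> n" "i < K"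
  shows "shuffle K i (Suc L) y s \<in> {..<K} \<rightarrow>\<^sub>E perms n"
proof -
  have "s k \<circ> Transposition.transpose (Suc L) (y k) \<in> perms n" if "k < K" "k \<noteq> i" for k
  proof -
    have "Transposition.transpose (Suc L) (y k) permutes {1..n}"
      using that assms by (intro permutes_swap_id) (auto dest!: PiE_mem[where x=k])
    moreover have "s k permutes {1..n}" using that assms(1) by (auto simp: perms_def dest!: PiE_mem[where x=k])
    ultimately show ?thesis unfolding perms_def by (simp add: permutes_compose)
  qed
  moreover have "s i \<in> perms n" using PiE_mem[OF assms(1), of i] assms(4) by simp
  ultimately show ?thesis unfolding shuffle_def restrict_PiE_iff by simp
qed

lemma shuffle_shuffle:
  assumes "s \<in> {..<K} \<rightarrow>\<^sub>E A"
  shows "shuffle K i l y (shuffle K i l y s) = s"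
proof
  fix k show "shuffle K i l y (shuffle K i l y s) k = s k"
    by (cases "k < K") (auto simp: shuffle_def comp_assoc PiE_arb[OF assms])
qed

text \<open>Both transposed columns lie beyond \<open>L\<close>, so the columns that define the set
  do not change.\<close>

lemma shuffle_covered:
  assumes "s \<in> covered n K i L" "y \<in> ({..<K} - {i}) \<rightarrow>\<^sub>E {Suc L..n}" "Suc L \<le> n" "i < K"
  shows "shuffle K i (Suc L) y s \<in> covered n K i L"
proof -
  have same: "shuffle K i (Suc L) y s k l = s k l" if "k < K" "l \<in> {1..L}" for k l
  proof (cases "k = i")
    case False
    then have "y k \<ge> Suc L" using assms(2) that by (auto dest!: PiE_mem[where x=k])
    then show ?thesis using that False by (auto simp: shuffle_def Transposition.transpose_def)
  qed (use that in \<open>auto simp: shuffle_def\<close>)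
  show ?thesis
    using assms(1) shuffle_PiE[OF _ assms(2-4), of s] unfolding covered_def
    by (simp add: same assms(4) cong: conj_cong)
qed

text \<open>Double counting of the pairs \<open>(s, y)\<close> for which column \<open>Suc L\<close> of the shuffled tuple is not
  covered: for fixed \<open>y\<close> the shuffle is an involution, while for fixed \<open>s\<close> at most one of the
  \<open>n - L\<close> values of each \<open>y k\<close> is excluded.\<close>

lemma card_covered_Suc:
  assumes L: "Suc L \<le> n" and i: "i < K"
  shows "card (covered n K i L) * (n - Suc L) ^ (K - 1)
     \<le> card (covered n K i L - covered n K i (Suc L)) * (n - L) ^ (K - 1)"
proof -
  define C where "C = covered n K i L"
  define U where "U = covered n K i L - covered n K i (Suc L)"
  define Y where "Y = ({..<K} - {i}) \<rightarrow>\<^sub>E {Suc L..n}"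
  let ?sh = "shuffle K i (Suc L)"
  have finC: "finite C" "finite U" unfolding C_def U_def by (simp_all add: finite_covered)
  have finY: "finite Y" unfolding Y_def by (intro finite_PiE) auto
  have cardY: "card Y = (n - L) ^ (K - 1)"
    unfolding Y_def using i by (subst card_PiE) auto
  have CP: "C \<subseteq> {..<K} \<rightarrow>\<^sub>E perms n" by (auto simp: C_def covered_def)
  have fixed_y: "card {s\<in>C. ?sh y s \<in> U} = card U" if "y \<in> Y" for y
  proof (rule bij_betw_same_card)
    show "bij_betw (?sh y) {s\<in>C. ?sh y s \<in> U} U"
    proof (rule bij_betw_byWitness[where f' = "?sh y"])
      show "\<forall>s\<in>{s\<in>C. ?sh y s \<in> U}. ?sh y (?sh y s) = s"
        using CP shuffle_shuffle by blast
      show "\<forall>s\<in>U. ?sh y (?sh y s) = s"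
        using CP shuffle_shuffle unfolding U_def C_def by blast
      show "?sh y ` U \<subseteq> {s\<in>C. ?sh y s \<in> U}"
      proof
        fix t assume "t \<in> ?sh y ` U"
        then obtain s where s: "s \<in> U" "t = ?sh y s" by auto
        then have "s \<in> C" by (auto simp: U_def C_def)
        then have "?sh y t = s" using CP shuffle_shuffle s by blast
        moreover have "t \<in> C"
          unfolding s C_def using \<open>s \<in> C\<close> that L i by (intro shuffle_covered) (auto simp: C_def Y_def)
        ultimately show "t \<in> {s\<in>C. ?sh y s \<in> U}" using s by auto
      qed
    qed auto
  qed
  have fixed_s: "(n - Suc L) ^ (K - 1) \<le> card {y\<in>Y. ?sh y s \<in> U}" if s: "s \<in> C" for s
  proof -
    \<comment> \<open>These choices of \<open>y\<close> keep the value \<open>s i (Suc L)\<close>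
      out of column \<open>Suc L\<close> of every other permutation. They form a product set, so
      \<open>k\<close> can be treated separately.\<close>
    define Z where "Z = (\<Pi>\<^sub>E k\<in>{..<K} - {i}. {v\<in>{Suc L..n}. s k v \<noteq> s i (Suc L)})"
    have "Z \<subseteq> {y\<in>Y. ?sh y s \<in> U}"
    proof
      fix y assume y: "y \<in> Z"
      then have yY: "y \<in> Y" unfolding Z_def Y_def by (auto simp: PiE_iff)
      have "?sh y s k (Suc L) \<noteq> ?sh y s i (Suc L)" if "k < K" "k \<noteq> i" for k
      proof -
        have "s k (y k) \<noteq> s i (Suc L)"
          using PiE_mem[OF y[unfolded Z_def], of k] that by simp
        then show ?thesis using that i by (simp add: shuffle_def)
      qed
      then have "?sh y s \<notin> covered n K i (Suc L)"
        unfolding covered_def by (auto intro!: bexI[of _ "Suc L"])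
      moreover have "?sh y s \<in> C"
        unfolding C_def using s yY L i by (intro shuffle_covered) (auto simp: C_def Y_def)
      ultimately show "y \<in> {y\<in>Y. ?sh y s \<in> U}" using yY by (auto simp: U_def C_def)
    qed
    then have "card Z \<le> card {y\<in>Y. ?sh y s \<in> U}" by (intro card_mono) (auto simp: finY)
    moreover have "(n - Suc L) ^ (K - 1) \<le> card Z"
    proof -
      have "n - Suc L \<le> card {v\<in>{Suc L..n}. s k v \<noteq> s i (Suc L)}" if "k \<in> {..<K} - {i}" for k
      proof -
        have "s k \<in> perms n" using that s CP by (auto intro: PiE_mem)
        then have inj: "inj (s k)" unfolding perms_def by (auto intro: permutes_inj)
        \<comment> \<open>By injectivity only \<open>w\<close> can be mapped to the forbidden value,
          so at least \<open>n - Suc L\<close> of the \<open>n - L\<close> candidates remain,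
          whether or not \<open>w\<close> is one of them.\<close>
        define w where "w = inv (s k) (s i (Suc L))"
        have "{Suc L..n} - {w} \<subseteq> {v\<in>{Suc L..n}. s k v \<noteq> s i (Suc L)}"
          using inj unfolding w_def by (auto dest!: sym[where t = "s i (Suc L)"])
        then have "card ({Suc L..n} - {w}) \<le> card {v\<in>{Suc L..n}. s k v \<noteq> s i (Suc L)}"
          by (intro card_mono) auto
        moreover have "n - Suc L \<le> card ({Suc L..n} - {w})"
          using diff_card_le_card_Diff[of "{w}" "{Suc L..n}"] by simp
        ultimately show ?thesis by simp
      qed
      then have "(\<Prod>k\<in>{..<K} - {i}. n - Suc L) \<le> (\<Prod>k\<in>{..<K} - {i}. card {v\<in>{Suc L..n}. s k v \<noteq> s i (Suc L)})"
        by (intro prod_mono) auto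
      then show ?thesis unfolding Z_def using i by (subst card_PiE) auto
    qed
    ultimately show ?thesis by simp
  qed
  have "card C * (n - Suc L) ^ (K - 1) \<le> (\<Sum>s\<in>C. card {y\<in>Y. ?sh y s \<in> U})"
    using sum_bounded_below[of C "(n - Suc L) ^ (K - 1)" "\<lambda>s. card {y\<in>Y. ?sh y s \<in> U}"] fixed_s by simp
  also have "\<dots> = (\<Sum>y\<in>Y. card {s\<in>C. ?sh y s \<in> U})"
    by (rule sum_multicount_gen[symmetric]) (auto simp: finC finY)
  also have "\<dots> = card U * (n - L) ^ (K - 1)"
    using fixed_y cardY by simp
  finally show ?thesis unfolding C_def U_def .
qed

text \<open>By \<open>card_covered_Suc\<close>, column \<open>Suc L\<close> removes at least a
  fraction \<open>(1 - 1 / (n - L)) ^ (K - 1)\<close> of the tuples still covered. Bounding all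
  these fractions below by the one at \<open>M\<close> makes the estimate geometric.\<close>

lemma card_covered_le:
  assumes i: "i < K" and "L \<le> M" "M < n"
  shows "real (card (covered n K i L)) \<le> fact n ^ K * (1 - (1 - 1 / real (n - M)) ^ (K - 1)) ^ L"
  using assms(2)
proof (induction L)
  case 0
  have "covered n K i 0 = {..<K} \<rightarrow>\<^sub>E perms n" by (auto simp: covered_def)
  then show ?case by (simp add: card_PiE card_perms)
next
  case (Suc L)
  define c c' r where "c = real (card (covered n K i L))"
    and "c' = real (card (covered n K i (Suc L)))" and "r = (1 - 1 / real (n - L)) ^ (K - 1)"
  have sub: "covered n K i (Suc L) \<subseteq> covered n K i L" by (auto simp: covered_def)
  then have le: "card (covered n K i (Suc L)) \<le> card (covered n K i L)"
    by (simp add: card_mono finite_covered)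
  have "card (covered n K i L - covered n K i (Suc L)) = card (covered n K i L) - card (covered n K i (Suc L))"
    using sub by (simp add: card_Diff_subset finite_covered)
  then have d: "real (card (covered n K i L - covered n K i (Suc L))) = c - c'"
    using le by (simp add: c_def c'_def of_nat_diff)
  have "real (card (covered n K i L) * (n - Suc L) ^ (K - 1))
      \<le> real (card (covered n K i L - covered n K i (Suc L)) * (n - L) ^ (K - 1))"
    using Suc.prems assms by (intro of_nat_mono card_covered_Suc) auto
  then have "c * real (n - Suc L) ^ (K - 1) \<le> (c - c') * real (n - L) ^ (K - 1)"
    using d by (simp add: c_def)
  moreover have pos: "real (n - L) > 0" using Suc.prems assms by simp
  ultimately have "c * (real (n - Suc L) ^ (K - 1) / real (n - L) ^ (K - 1)) \<le> c - c'"
    by (simp add: field_simps)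
  moreover have "real (n - Suc L) / real (n - L) = 1 - 1 / real (n - L)"
    using pos Suc.prems assms by (simp add: field_simps of_nat_diff)
  ultimately have "c' \<le> c * (1 - r)"
    unfolding r_def by (simp add: power_divide[symmetric] algebra_simps)
  also have "\<dots> \<le> c * (1 - (1 - 1 / real (n - M)) ^ (K - 1))"
  proof -
    have "1 / real (n - L) \<le> 1 / real (n - M)" using Suc.prems assms by (intro divide_left_mono) auto
    moreover have "1 / real (n - M) \<le> 1" using assms by simp
    ultimately have "(1 - 1 / real (n - M)) ^ (K - 1) \<le> r" unfolding r_def by (intro power_mono) auto
    then show ?thesis by (intro mult_left_mono) (auto simp: c_def)
  qed
  also have "\<dots> \<le> (fact n ^ K * (1 - (1 - 1 / real (n - M)) ^ (K - 1)) ^ L) * (1 - (1 - 1 / real (n - M)) ^ (K - 1))"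
  proof -
    have "(1 - 1 / real (n - M)) ^ (K - 1) \<le> 1" using assms by (intro power_le_one) auto
    then show ?thesis using Suc unfolding c_def by (intro mult_right_mono) auto
  qed
  finally show ?case by (simp add: c'_def mult_ac)
qed

section \<open>Distinct subset sums\<close>

lemma prob_space_uniform_interval: "a < b \<Longrightarrow> prob_space (uniform_measure lborel {a..b::real})"
  by (rule prob_space_uniform_measure) auto

lemma emeasure_uniform_singleton:
  "emeasure (uniform_measure lborel {a..b::real}) {x} = 0"
proof -
  have "emeasure lborel ({a..b} \<inter> {x}) \<le> emeasure lborel {x}" by (intro emeasure_mono) auto
  then show ?thesis by (subst emeasure_uniform_measure) auto
qed

text \<open>With the other coordinates fixed, a single value of \<open>p i\<close> makes the form
  vanish, and points are null for the uniform law; Fubini does the rest.\<close>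

lemma AE_PiM_linear_form_nonzero:
  fixes c :: "'i \<Rightarrow> real"
  assumes "a < b" "finite I" "i \<in> I" "c i \<noteq> 0"
  shows "AE p in PiM I (\<lambda>_. uniform_measure lborel {a..b}). (\<Sum>j\<in>I. c j * p j) \<noteq> 0"
proof -
  let ?U = "uniform_measure lborel {a..b} :: real measure"
  interpret U: prob_space ?U using assms(1) by (rule prob_space_uniform_interval)
  interpret product_sigma_finite "\<lambda>_::'i. ?U" ..
  define J where "J = I - {i}"
  have I: "I = insert i J" "finite J" "i \<notin> J" using assms by (auto simp: J_def)
  let ?N = "{p \<in> space (PiM I (\<lambda>_. ?U)). (\<Sum>j\<in>I. c j * p j) = 0}"
  have meas: "?N \<in> sets (PiM I (\<lambda>_. ?U))" by measurable
  have "emeasure (PiM I (\<lambda>_. ?U)) ?N = (\<integral>\<^sup>+ p. indicator ?N p \<partial>PiM I (\<lambda>_. ?U))"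
    using meas by simp
  also have "\<dots> = (\<integral>\<^sup>+ p. (\<integral>\<^sup>+ y. indicator ?N (p(i := y)) \<partial>?U) \<partial>PiM J (\<lambda>_. ?U))"
    unfolding I(1) using meas I by (intro product_nn_integral_insert) auto
  also have "\<dots> = (\<integral>\<^sup>+ p. 0 \<partial>PiM J (\<lambda>_. ?U))"
  proof (intro nn_integral_cong)
    fix p
    define x where "x = - (\<Sum>j\<in>J. c j * p j) / c i"
    have "indicator ?N (p(i := y)) \<le> (indicator {x} y :: ennreal)" for y
    proof -
      have "(\<Sum>j\<in>J. c j * (p(i := y)) j) = (\<Sum>j\<in>J. c j * p j)"
        using I(3) by (intro sum.cong) auto
      then have "(\<Sum>j\<in>I. c j * (p(i := y)) j) = c i * y + (\<Sum>j\<in>J. c j * p j)"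
        unfolding I(1) using I by simp
      then show ?thesis
        using assms(4) by (auto simp: indicator_def x_def field_simps)
    qed
    then have "(\<integral>\<^sup>+ y. indicator ?N (p(i := y)) \<partial>?U) \<le> (\<integral>\<^sup>+ y. indicator {x} y \<partial>?U)"
      by (intro nn_integral_mono)
    also have "\<dots> = 0" by (simp add: emeasure_uniform_singleton)
    finally show "(\<integral>\<^sup>+ y. indicator ?N (p(i := y)) \<partial>?U) = 0" by simp
  qed
  finally have "emeasure (PiM I (\<lambda>_. ?U)) ?N = 0" by simp
  then show ?thesis using meas by (intro AE_I[of _ _ ?N]) auto
qed

text \<open>For \<open>A \<noteq> B\<close> the difference of the two sums is a linear form with
  coefficients -1, 0, 1 that is nonzero on the symmetric difference. There are finitely many
  pairs.\<close>

lemma AE_PiM_distinct_subset_sums: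
  assumes "a < b" "finite I"
  shows "AE p in PiM I (\<lambda>_. uniform_measure lborel {a..b::real}). inj_on (sum p) (Pow I)"
proof -
  have "AE p in PiM I (\<lambda>_. uniform_measure lborel {a..b}).
      \<forall>A\<in>Pow I. \<forall>B\<in>Pow I. A \<noteq> B \<longrightarrow> sum p A \<noteq> sum p B"
  proof (intro AE_finite_allI)
    fix A B assume AB: "A \<in> Pow I" "B \<in> Pow I"
    show "AE p in PiM I (\<lambda>_. uniform_measure lborel {a..b}). A \<noteq> B \<longrightarrow> sum p A \<noteq> sum p B"
    proof (cases "A = B")
      case False
      then obtain i where i: "i \<in> I" "i \<in> A \<longleftrightarrow> i \<notin> B" using AB by blast
      define c :: "_ \<Rightarrow> real" where "c = (\<lambda>j. indicator A j - indicator B j)"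
      have "(\<Sum>j\<in>I. c j * p j) = sum p A - sum p B" for p
      proof -
        have "(\<Sum>j\<in>I. indicator X j * p j) = sum p X" if "X \<subseteq> I" for X
          using that assms(2) by (simp add: indicator_def if_distrib[of "\<lambda>x. x * _"] sum.inter_restrict[symmetric] inf.absorb2 cong: if_cong)
        then show ?thesis using AB unfolding c_def by (simp add: left_diff_distrib sum_subtractf)
      qed
      moreover have "c i \<noteq> 0" using i by (auto simp: c_def indicator_def)
      ultimately show ?thesis
        using AE_PiM_linear_form_nonzero[OF assms i(1), of c] by auto
    qed simp
  qed (use assms in auto)
  then show ?thesis by (rule eventually_mono) (auto simp: inj_on_def)
qed

text \<open>The factors are measures on the whole real line, so the bound holds only almost surely.
  Together with \<open>0 < a\<close> it makes all values positive.\<close>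

lemma AE_PiM_uniform_ge:
  assumes "a < b" "finite I"
  shows "AE p in PiM I (\<lambda>_. uniform_measure lborel {a..b::real}). \<forall>i\<in>I. a \<le> p i"
proof (intro AE_finite_allI assms(2))
  fix i assume i: "i \<in> I"
  have "AE x in uniform_measure lborel {a..b}. a \<le> x"
    by (rule AE_uniform_measureI) auto
  then show "AE p in PiM I (\<lambda>_. uniform_measure lborel {a..b}). a \<le> p i"
    using i prob_space_uniform_interval[OF assms(1)] by (intro AE_PiM_component) auto
qed

section \<open>Measurability of the success event\<close>

lemma sf_run_Nil_iff: "sf_run [] ps As ps' As' \<longleftrightarrow> ps' = ps \<and> As' = As"
  by (auto elim: sf_run.cases intro: sf_done)

text \<open>Unfolds the inductive relation along the input list, with the choice of \<open>T\<close>
  ranging over a finite set, as the measurability proof requires.\<close>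

lemma sf_run_Cons_iff:
  "sf_run ((x, q) # rest) ps As ps' As' \<longleftrightarrow>
     (\<exists>T\<in>Pow {..<length ps}. q = (\<Sum>k\<in>T. ps ! k) \<and>
        sf_run rest ps (map (\<lambda>k. if k \<in> T then insert x (As ! k) else As ! k) [0..<length As]) ps' As') \<or>
     (\<forall>T\<in>Pow {..<length ps}. q \<noteq> (\<Sum>k\<in>T. ps ! k)) \<and> sf_run rest (ps @ [q]) (As @ [{x}]) ps' As'"
  by (auto elim!: sf_run.cases[of "_ # _"] intro: sf_old sf_new)

text \<open>Separates positions from values: a quantifier over lists containing reals becomes one
  over lists of positions, a countable type.\<close>

lemma sf_input_iff:
  "sf_input n F xs \<longleftrightarrow> (\<exists>ys. xs = map (\<lambda>x. (x, F (fst x) (snd x))) ys \<and> distinct ys \<and>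
     (\<forall>i\<in>{1..n}. \<forall>j\<in>{1..n}. (i, j) \<in> set ys \<longleftrightarrow> F i j \<noteq> 0) \<and> (\<forall>x\<in>set ys. fst x \<in> {1..n} \<and> snd x \<in> {1..n}) \<and>
     (\<forall>i<length ys. \<forall>j<length ys. i \<le> j \<longrightarrow> F (fst (ys ! i)) (snd (ys ! i)) \<le> F (fst (ys ! j)) (snd (ys ! j))))"
  (is "_ \<longleftrightarrow> (\<exists>ys. ?R ys)")
proof
  assume inp: "sf_input n F xs"
  have v: "F (fst (fst (xs ! i))) (snd (fst (xs ! i))) = snd (xs ! i)" if "i < length xs" for i
    using inp nth_mem[OF that] unfolding sf_input_def by (cases "xs ! i") force
  have dom: "set (map fst xs) = {(i, j). i \<in> {1..n} \<and> j \<in> {1..n} \<and> F i j \<noteq> 0}"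
    using inp unfolding sf_input_def by blast
  show "\<exists>ys. ?R ys"
  proof (rule exI[of _ "map fst xs"], intro conjI)
    show "xs = map (\<lambda>x. (x, F (fst x) (snd x))) (map fst xs)"
      by (rule nth_equalityI) (auto simp: v prod_eq_iff)
    show "\<forall>i<length (map fst xs). \<forall>j<length (map fst xs). i \<le> j \<longrightarrow>
        F (fst (map fst xs ! i)) (snd (map fst xs ! i)) \<le> F (fst (map fst xs ! j)) (snd (map fst xs ! j))"
      using inp unfolding sf_input_def sorted_iff_nth_mono by (auto simp: v)
    show "distinct (map fst xs)" using inp unfolding sf_input_def by blast
    show "\<forall>i\<in>{1..n}. \<forall>j\<in>{1..n}. (i, j) \<in> set (map fst xs) \<longleftrightarrow> F i j \<noteq> 0"
      unfolding dom by blast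
    show "\<forall>x\<in>set (map fst xs). fst x \<in> {1..n} \<and> snd x \<in> {1..n}"
      unfolding dom by (simp add: case_prod_beta)
  qed
next
  assume "\<exists>ys. ?R ys"
  then obtain ys where ys: "?R ys" ..
  then have xs: "xs = map (\<lambda>x. (x, F (fst x) (snd x))) ys" by blast
  then have fsts: "map fst xs = ys" by (simp add: comp_def)
  have dom: "(i, j) \<in> set ys \<longleftrightarrow> i \<in> {1..n} \<and> j \<in> {1..n} \<and> F i j \<noteq> 0" for i j
  proof (cases "i \<in> {1..n} \<and> j \<in> {1..n}")
    case True
    then show ?thesis using ys by blast
  next
    case False
    then have "(i, j) \<notin> set ys" using ys by force
    then show ?thesis using False by blast
  qed
  show "sf_input n F xs"
    unfolding sf_input_def fsts
  proof (intro conjI)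
    show "set ys = {(i, j). i \<in> {1..n} \<and> j \<in> {1..n} \<and> F i j \<noteq> 0}"
      using dom by (simp add: set_eq_iff)
    show "sorted (map snd xs)"
      unfolding sorted_iff_nth_mono xs using ys by simp
    show "\<forall>((i, j), q)\<in>set xs. q = F i j" unfolding xs by auto
  qed (use ys in blast)
qed

text \<open>The positions and the sets \<open>As\<close> are deterministic parameters here, only the values depend on \<open>\<omega>\<close>.\<close>

lemma measurable_sf_run:
  assumes F: "\<And>i j. (\<lambda>\<omega>. F \<omega> i j) \<in> borel_measurable M"
    and R: "\<And>gs As. (\<And>g. g \<in> set gs \<Longrightarrow> g \<in> borel_measurable M) \<Longrightarrow>
             Measurable.pred M (\<lambda>\<omega>. R \<omega> (map (\<lambda>g. g \<omega>) gs) As)"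
    and "\<And>g. g \<in> set gs \<Longrightarrow> g \<in> borel_measurable M"
  shows "Measurable.pred M (\<lambda>\<omega>. \<forall>ps' As'.
     sf_run (map (\<lambda>x. (x, F \<omega> (fst x) (snd x))) ys) (map (\<lambda>g. g \<omega>) gs) As ps' As' \<longrightarrow> R \<omega> ps' As')"
  using assms(3)
proof (induction ys arbitrary: gs As)
  case Nil
  then show ?case using R by (simp add: sf_run_Nil_iff)
next
  case (Cons y ys)
  let ?P = "\<lambda>gs As \<omega>. \<forall>ps' As'. sf_run (map (\<lambda>x. (x, F \<omega> (fst x) (snd x))) ys) (map (\<lambda>g. g \<omega>) gs) As ps' As' \<longrightarrow> R \<omega> ps' As'"
  define h where "h = (\<lambda>\<omega>. F \<omega> (fst y) (snd y))"
  have h[measurable]: "h \<in> borel_measurable M" unfolding h_def by (rule F)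
  define sm where "sm = (\<lambda>T \<omega>. \<Sum>k\<in>T. (gs ! k) \<omega>)"
  have sm[measurable]: "sm T \<in> borel_measurable M" if "T \<in> Pow {..<length gs}" for T
    unfolding sm_def using that Cons.prems by (intro borel_measurable_sum) auto
  define upd where "upd = (\<lambda>T. map (\<lambda>k. if k \<in> T then insert y (As ! k) else As ! k) [0..<length As])"
  \<comment> \<open>A statement about all runs splits along the first transition: one conjunct for
    each of the finitely many \<open>T\<close>, and one for opening a new value
    \<open>h\<close>.\<close>
  have "(\<forall>ps' As'. sf_run (map (\<lambda>x. (x, F \<omega> (fst x) (snd x))) (y # ys)) (map (\<lambda>g. g \<omega>) gs) As ps' As' \<longrightarrow> R \<omega> ps' As')
     \<longleftrightarrow> (\<forall>T\<in>Pow {..<length gs}. h \<omega> = sm T \<omega> \<longrightarrow> ?P gs (upd T) \<omega>) \<and>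
         ((\<forall>T\<in>Pow {..<length gs}. h \<omega> \<noteq> sm T \<omega>) \<longrightarrow> ?P (gs @ [h]) (As @ [{y}]) \<omega>)" for \<omega>
  proof -
    have "(\<Sum>k\<in>T. map (\<lambda>g. g \<omega>) gs ! k) = sm T \<omega>" if "T \<in> Pow {..<length gs}" for T
      unfolding sm_def using that by (intro sum.cong) auto
    then show ?thesis
      unfolding list.map sf_run_Cons_iff length_map upd_def map_append h_def by (auto 0 3)
  qed
  moreover have "Measurable.pred M (\<lambda>\<omega>. (\<forall>T\<in>Pow {..<length gs}. h \<omega> = sm T \<omega> \<longrightarrow> ?P gs (upd T) \<omega>) \<and>
         ((\<forall>T\<in>Pow {..<length gs}. h \<omega> \<noteq> sm T \<omega>) \<longrightarrow> ?P (gs @ [h]) (As @ [{y}]) \<omega>))"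
  proof (intro pred_intros_logic pred_intros_finite)
    show "Measurable.pred M (?P gs (upd T))" for T using Cons by auto
    show "Measurable.pred M (?P (gs @ [h]) (As @ [{y}]))" using Cons.prems h by (intro Cons.IH) auto
    show "Measurable.pred M (\<lambda>\<omega>. h \<omega> = sm T \<omega>)" if "T \<in> Pow {..<length gs}" for T
      using sm[OF that] by measurable
    show "Measurable.pred M (\<lambda>\<omega>. h \<omega> = sm T \<omega>)" if "T \<in> Pow {..<length gs}" for T
      using sm[OF that] by measurable
  qed auto
  ultimately show ?case by simp
qed

lemma measurable_recovers:
  fixes f :: "'a \<Rightarrow> (nat \<Rightarrow> nat) \<Rightarrow> real"
  assumes f: "\<And>\<sigma>. \<sigma> \<in> perms n \<Longrightarrow> (\<lambda>\<omega>. f \<omega> \<sigma>) \<in> borel_measurable M"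
    and gs: "\<And>g. g \<in> set gs \<Longrightarrow> g \<in> borel_measurable M"
  shows "Measurable.pred M (\<lambda>\<omega>. recovers n (f \<omega>) (map (\<lambda>g. g \<omega>) gs) As)"
proof -
  \<comment> \<open>The quantifier over all functions \<sigma>s is uncountable, but only values
    below \<open>length gs\<close> matter, so a finite set of extensional functions suffices. The
    conditions independent of \<omega> are absorbed into it.\<close>
  define E where "E = {\<sigma>s \<in> {..<length gs} \<rightarrow>\<^sub>E perms n. length As = length gs \<and>
     (\<forall>k<length gs. As ! k = {(\<sigma>s k j, j) |j. j \<in> {1..n}}) \<and> inj_on \<sigma>s {..<length gs}}"
  have fin: "finite E" unfolding E_def by (auto intro!: finite_PiE finite_perms)
  define r :: "(nat \<Rightarrow> nat \<Rightarrow> nat) \<Rightarrow> (nat \<Rightarrow> nat) \<Rightarrow> 'a \<Rightarrow> real"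
    where "r = (\<lambda>\<sigma>s \<sigma> \<omega>. \<Sum>k<length gs. if \<sigma>s k = \<sigma> then (gs ! k) \<omega> else (0::real))"
  have r: "r \<sigma>s \<sigma> \<in> borel_measurable M" for \<sigma>s :: "nat \<Rightarrow> nat \<Rightarrow> nat" and \<sigma>
    unfolding r_def
  proof (intro borel_measurable_sum)
    fix k assume "k \<in> {..<length gs}"
    then show "(\<lambda>\<omega>. if \<sigma>s k = \<sigma> then (gs ! k) \<omega> else 0) \<in> borel_measurable M"
      using gs[of "gs ! k"] by auto
  qed
  have eq: "recovers n (f \<omega>) (map (\<lambda>g. g \<omega>) gs) As \<longleftrightarrow> (\<exists>\<sigma>s\<in>E. \<forall>\<sigma>\<in>perms n. f \<omega> \<sigma> = r \<sigma>s \<sigma> \<omega>)" for \<omega>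
  proof
    assume "recovers n (f \<omega>) (map (\<lambda>g. g \<omega>) gs) As"
    then obtain \<sigma>s where len: "length As = length gs"
      and s: "\<And>k. k < length gs \<Longrightarrow> \<sigma>s k \<in> perms n \<and> As ! k = {(\<sigma>s k j, j) |j. j \<in> {1..n}}"
      and inj: "inj_on \<sigma>s {..<length gs}"
      and f: "\<And>\<sigma>. \<sigma> \<in> perms n \<Longrightarrow> f \<omega> \<sigma> = (\<Sum>k<length gs. if \<sigma>s k = \<sigma> then map (\<lambda>g. g \<omega>) gs ! k else 0)"
      unfolding recovers_def length_map by blast
    have "restrict \<sigma>s {..<length gs} \<in> E"
      using len s inj unfolding E_def by (simp add: restrict_PiE_iff inj_on_restrict_eq)
    moreover have "f \<omega> \<sigma> = r (restrict \<sigma>s {..<length gs}) \<sigma> \<omega>" if "\<sigma> \<in> perms n" for \<sigma>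
      unfolding f[OF that] r_def by (intro sum.cong) auto
    ultimately show "\<exists>\<sigma>s\<in>E. \<forall>\<sigma>\<in>perms n. f \<omega> \<sigma> = r \<sigma>s \<sigma> \<omega>" by blast
  next
    assume "\<exists>\<sigma>s\<in>E. \<forall>\<sigma>\<in>perms n. f \<omega> \<sigma> = r \<sigma>s \<sigma> \<omega>"
    then obtain \<sigma>s where s: "\<sigma>s \<in> E" and f: "\<And>\<sigma>. \<sigma> \<in> perms n \<Longrightarrow> f \<omega> \<sigma> = r \<sigma>s \<sigma> \<omega>" by blast
    have "f \<omega> \<sigma> = (\<Sum>k<length gs. if \<sigma>s k = \<sigma> then map (\<lambda>g. g \<omega>) gs ! k else 0)" if "\<sigma> \<in> perms n" for \<sigma>
      unfolding f[OF that] r_def by (intro sum.cong) auto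
    moreover have "\<sigma>s k \<in> perms n" if "k < length gs" for k
      using s that unfolding E_def by (auto simp: PiE_iff)
    ultimately show "recovers n (f \<omega>) (map (\<lambda>g. g \<omega>) gs) As"
      using s unfolding recovers_def E_def length_map by blast
  qed
  show ?thesis unfolding eq
  proof (intro pred_intros_finite fin finite_perms)
    fix \<sigma>s \<sigma> assume "\<sigma> \<in> perms n"
    then show "Measurable.pred M (\<lambda>\<omega>. f \<omega> \<sigma> = r \<sigma>s \<sigma> \<omega>)"
      using f[of \<sigma>] r[of \<sigma>s \<sigma>] by measurable
  qed
qed

lemma measurable_sparsest_fit_recovers:
  assumes f: "\<And>\<sigma>. \<sigma> \<in> perms n \<Longrightarrow> (\<lambda>\<omega>. f \<omega> \<sigma>) \<in> borel_measurable M"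
  shows "Measurable.pred M (\<lambda>\<omega>. sparsest_fit_recovers n (f \<omega>))"
proof -
  define F where "F = (\<lambda>\<omega>. fhat n (f \<omega>))"
  have F[measurable]: "(\<lambda>\<omega>. F \<omega> i j) \<in> borel_measurable M" for i j
    unfolding F_def fhat_def
  proof (intro borel_measurable_sum)
    fix \<sigma> assume "\<sigma> \<in> perms n"
    then show "(\<lambda>\<omega>. if \<sigma> j = i then f \<omega> \<sigma> else 0) \<in> borel_measurable M" using f[of \<sigma>] by auto
  qed
  define Q where "Q = (\<lambda>\<omega> ys. distinct ys \<and>
     (\<forall>i\<in>{1..n}. \<forall>j\<in>{1..n}. (i, j) \<in> set ys \<longleftrightarrow> F \<omega> i j \<noteq> 0) \<and> (\<forall>x\<in>set ys. fst x \<in> {1..n} \<and> snd x \<in> {1..n}) \<and>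
     (\<forall>i<length ys. \<forall>j<length ys. i \<le> j \<longrightarrow> F \<omega> (fst (ys ! i)) (snd (ys ! i)) \<le> F \<omega> (fst (ys ! j)) (snd (ys ! j))))"
  have Q: "Measurable.pred M (\<lambda>\<omega>. Q \<omega> ys)" for ys
    unfolding Q_def by measurable
  \<comment> \<open>Success becomes a conjunction over position lists \<open>ys\<close>, hence a
    countable intersection of measurable events.\<close>
  have "sparsest_fit_recovers n (f \<omega>) \<longleftrightarrow> (\<forall>ys. Q \<omega> ys \<longrightarrow>
      (\<forall>ps As. sf_run (map (\<lambda>x. (x, F \<omega> (fst x) (snd x))) ys) (map (\<lambda>g. g \<omega>) []) [] ps As \<longrightarrow> recovers n (f \<omega>) ps As))" for \<omega>
  proof -
    have input: "sf_input n (fhat n (f \<omega>)) xs \<longleftrightarrow> (\<exists>ys. xs = map (\<lambda>x. (x, F \<omega> (fst x) (snd x))) ys \<and> Q \<omega> ys)" for xs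
      unfolding sf_input_iff Q_def F_def ..
    show ?thesis unfolding sparsest_fit_recovers_def input list.map by blast
  qed
  moreover have "Measurable.pred M (\<lambda>\<omega>. \<forall>ps As. sf_run (map (\<lambda>x. (x, F \<omega> (fst x) (snd x))) ys)
      (map (\<lambda>g. g \<omega>) []) [] ps As \<longrightarrow> recovers n (f \<omega>) ps As)" for ys
    using F f by (intro measurable_sf_run[where R = "\<lambda>\<omega>. recovers n (f \<omega>)"] measurable_recovers) auto
  ultimately show ?thesis
    using Q by (simp only:) (intro pred_intros_countable pred_intros_logic)
qed

lemma measurable_rm_f:
  "(\<lambda>\<omega>. rm_f K \<omega> \<sigma>) \<in> borel_measurable (rm_space n K a b)"
proof -
  have [measurable]: "Measurable.pred (rm_space n K a b) (\<lambda>\<omega>. fst \<omega> i = \<sigma>)" if "i < K" for i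
  proof -
    have "(\<lambda>\<omega>. fst \<omega> i) \<in> rm_space n K a b \<rightarrow>\<^sub>M measure_pmf (pmf_of_set (perms n))"
      unfolding rm_space_def
      by (rule measurable_compose[OF measurable_fst measurable_component_singleton]) (use that in auto)
    then have "(\<lambda>\<omega>. fst \<omega> i) \<in> rm_space n K a b \<rightarrow>\<^sub>M count_space UNIV" by simp
    then show ?thesis by measurable
  qed
  have [measurable]: "(\<lambda>\<omega>. snd \<omega> i) \<in> borel_measurable (rm_space n K a b)" if "i < K" for i
  proof -
    have "(\<lambda>\<omega>. snd \<omega> i) \<in> rm_space n K a b \<rightarrow>\<^sub>M uniform_measure lborel {a..b}"
      unfolding rm_space_def
      by (rule measurable_compose[OF measurable_snd measurable_component_singleton]) (use that in auto)
    also have "rm_space n K a b \<rightarrow>\<^sub>M uniform_measure lborel {a..b} = borel_measurable (rm_space n K a b)"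
      by (intro measurable_cong_sets) auto
    finally show ?thesis .
  qed
  show ?thesis unfolding rm_f_eq_sum
  proof (intro borel_measurable_sum measurable_If)
    fix i assume "i \<in> {..<K}"
    then have "Measurable.pred (rm_space n K a b) (\<lambda>\<omega>. fst \<omega> i = \<sigma> \<and> (\<forall>j\<in>{..<i}. fst \<omega> j \<noteq> \<sigma>))"
      by (intro pred_intros_logic pred_intros_finite) auto
    then show "{\<omega> \<in> space (rm_space n K a b). fst \<omega> i = \<sigma> \<and> (\<forall>j<i. fst \<omega> j \<noteq> \<sigma>)} \<in> sets (rm_space n K a b)"
      by (simp add: pred_def lessThan_def)
  qed auto
qed

section \<open>Probability of recovery\<close>

text \<open>Union bound over \<open>i\<close> in counting form: if \<open>i\<close> has no witness
  among all \<open>n\<close> columns, then in particular it has none among the first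
  \<open>L\<close>.\<close>

lemma card_has_witnesses_ge:
  assumes "L < n"
  shows "fact n ^ K * (1 - real K * (1 - (1 - 1 / real (n - L)) ^ (K - 1)) ^ L)
     \<le> real (card {s \<in> {..<K} \<rightarrow>\<^sub>E perms n. has_witnesses n K s})"
proof -
  define W where "W = {s \<in> {..<K} \<rightarrow>\<^sub>E perms n. has_witnesses n K s}"
  let ?q = "(1 - (1 - 1 / real (n - L)) ^ (K - 1)) ^ L"
  have finP: "finite ({..<K} \<rightarrow>\<^sub>E perms n)" by (intro finite_PiE) (auto simp: finite_perms)
  have finW: "finite W" unfolding W_def using finP by simp
  have "{..<K} \<rightarrow>\<^sub>E perms n \<subseteq> W \<union> (\<Union>i<K. covered n K i L)"
  proof
    fix s assume s: "s \<in> {..<K} \<rightarrow>\<^sub>E perms n"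
    show "s \<in> W \<union> (\<Union>i<K. covered n K i L)"
    proof (cases "has_witnesses n K s")
      case False
      then obtain i where i: "i < K" "\<forall>j\<in>{1..n}. \<exists>k<K. k \<noteq> i \<and> s k j = s i j"
        unfolding has_witnesses_def by blast
      then have "s \<in> covered n K i L"
        unfolding covered_def using s assms by simp
      then show ?thesis using i(1) by blast
    qed (use s in \<open>simp add: W_def\<close>)
  qed
  then have "card ({..<K} \<rightarrow>\<^sub>E perms n) \<le> card (W \<union> (\<Union>i<K. covered n K i L))"
    using finW by (intro card_mono) (auto simp: finite_covered)
  also have "\<dots> \<le> card W + card (\<Union>i<K. covered n K i L)" by (rule card_Un_le)
  also have "\<dots> \<le> card W + (\<Sum>i<K. card (covered n K i L))"
    by (intro add_left_mono card_UN_le) simp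
  finally have "real (fact n ^ K) \<le> real (card W + (\<Sum>i<K. card (covered n K i L)))"
    by (intro of_nat_mono) (simp add: card_PiE card_perms)
  also have "\<dots> = real (card W) + (\<Sum>i<K. real (card (covered n K i L)))" by simp
  also have "(\<Sum>i<K. real (card (covered n K i L))) \<le> (\<Sum>i<K. fact n ^ K * ?q)"
    using assms by (intro sum_mono card_covered_le) auto
  finally show ?thesis unfolding W_def by (simp add: algebra_simps)
qed

text \<open>Passes from counting to probability. Elements of \<open>W\<close> are extensional, so
  each singleton is a box whose measure is a product, and \<open>W\<close> is a finite union of
  them.\<close>

lemma measure_PiM_pmf_of_set:
  assumes "finite I" "finite A" "A \<noteq> {}" "W \<subseteq> I \<rightarrow>\<^sub>E A"
  shows "W \<in> sets (PiM I (\<lambda>_. measure_pmf (pmf_of_set A)))"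
    and "measure (PiM I (\<lambda>_. measure_pmf (pmf_of_set A))) W = real (card W) / real (card A) ^ card I"
proof -
  let ?P = "PiM I (\<lambda>_. measure_pmf (pmf_of_set A))"
  interpret product_sigma_finite "\<lambda>_. measure_pmf (pmf_of_set A)" ..
  have finW: "finite W" using assms by (meson finite_PiE finite_subset)
  have single: "{s} = (\<Pi>\<^sub>E i\<in>I. {s i})" if "s \<in> W" for s
    using that assms(4) by (subst PiE_singleton) (auto simp: PiE_iff)
  have sets: "{s} \<in> sets ?P" if "s \<in> W" for s
    unfolding single[OF that] using assms(1) by (intro sets_PiM_I_finite) auto
  have val: "emeasure ?P {s} = ennreal (1 / real (card A) ^ card I)" if s: "s \<in> W" for s
  proof -
    have "emeasure ?P {s} = (\<Prod>i\<in>I. emeasure (measure_pmf (pmf_of_set A)) {s i})"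
      unfolding single[OF s] using assms(1) by (intro emeasure_PiM) auto
    also have "\<dots> = (\<Prod>i\<in>I. ennreal (1 / real (card A)))"
    proof (intro prod.cong refl)
      fix i assume "i \<in> I"
      then have "s i \<in> A" using s assms(4) by (auto intro: PiE_mem)
      then show "emeasure (measure_pmf (pmf_of_set A)) {s i} = ennreal (1 / real (card A))"
        using assms(2,3) by (simp add: emeasure_pmf_single)
    qed
    also have "\<dots> = ennreal (1 / real (card A) ^ card I)"
      by (simp add: ennreal_power power_one_over)
    finally show ?thesis .
  qed
  show "W \<in> sets ?P" using sets.finite_UN[of W "\<lambda>s. {s}" ?P] finW sets by simp
  have "measure ?P W = (\<Sum>s\<in>W. measure ?P {s})"
    using finW sets val by (intro measure_eq_sum_singleton) auto
  also have "\<dots> = (\<Sum>s\<in>W. 1 / real (card A) ^ card I)"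
    using val by (intro sum.cong refl) (simp add: measure_def)
  finally show "measure ?P W = real (card W) / real (card A) ^ card I" by simp
qed

text \<open>The exceptional set is enclosed in a measurable null set \<open>Z\<close>, as
  \<open>P\<close> is not assumed measurable; the cylinder over \<open>Z\<close> is then
  null.\<close>

lemma AE_pair_snd:
  assumes "sigma_finite_measure N" "AE y in N. P y"
  shows "AE \<omega> in M \<Otimes>\<^sub>M N. P (snd \<omega>)"
proof -
  interpret N: sigma_finite_measure N by fact
  obtain Z where Z: "{y \<in> space N. \<not> P y} \<subseteq> Z" "emeasure N Z = 0" "Z \<in> sets N"
    using AE_E[OF assms(2)] by blast
  show ?thesis
  proof (rule AE_I)
    show "{\<omega> \<in> space (M \<Otimes>\<^sub>M N). \<not> P (snd \<omega>)} \<subseteq> space M \<times> Z"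
      using Z(1) by (auto simp: space_pair_measure)
    show "space M \<times> Z \<in> sets (M \<Otimes>\<^sub>M N)" using Z(3) by auto
    show "emeasure (M \<Otimes>\<^sub>M N) (space M \<times> Z) = 0"
      using Z by (subst N.emeasure_pair_measure_Times) auto
  qed
qed

text \<open>Witnesses depend only on the permutations, distinctness of sums and positivity only on
  the values. The latter hold almost surely, so up to a null set the success event contains
  \<open>W \<times> space U\<close>, whose measure is \<open>measure P W\<close>.\<close>

lemma measure_sparsest_fit_recovers_ge:
  assumes "0 < a" "a < b" "L < n"
  shows "1 - real K * (1 - (1 - 1 / real (n - L)) ^ (K - 1)) ^ L
    \<le> measure (rm_space n K a b) {\<omega> \<in> space (rm_space n K a b). sparsest_fit_recovers n (rm_f K \<omega>)}"
proof -
  define P where "P = PiM {..<K} (\<lambda>_. measure_pmf (pmf_of_set (perms n)))"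
  define U where "U = PiM {..<K} (\<lambda>_. uniform_measure lborel {a..b})"
  define W where "W = {s \<in> {..<K} \<rightarrow>\<^sub>E perms n. has_witnesses n K s}"
  have space: "rm_space n K a b = P \<Otimes>\<^sub>M U" unfolding rm_space_def P_def U_def ..
  interpret P: prob_space P unfolding P_def by (intro prob_space_PiM prob_space_measure_pmf)
  interpret U: prob_space U unfolding U_def by (intro prob_space_PiM prob_space_uniform_interval assms)
  interpret PU: pair_prob_space P U ..
  have perms_ne: "perms n \<noteq> {}" using card_perms[of n] by auto
  have WP: "W \<subseteq> {..<K} \<rightarrow>\<^sub>E perms n" by (auto simp: W_def)
  note W = measure_PiM_pmf_of_set[OF _ finite_perms perms_ne WP, simplified, folded P_def]
  have "AE p in U. (\<forall>i\<in>{..<K}. a \<le> p i) \<and> inj_on (sum p) (Pow {..<K})"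
    unfolding U_def using AE_PiM_uniform_ge[OF assms(2)] AE_PiM_distinct_subset_sums[OF assms(2)]
    by (intro AE_conjI) auto
  then have AE: "AE \<omega> in P \<Otimes>\<^sub>M U. (\<forall>i\<in>{..<K}. a \<le> snd \<omega> i) \<and> inj_on (sum (snd \<omega>)) (Pow {..<K})"
    by (rule AE_pair_snd[rotated]) (rule U.sigma_finite_measure_axioms)
  have "1 - real K * (1 - (1 - 1 / real (n - L)) ^ (K - 1)) ^ L \<le> real (card W) / fact n ^ K"
    using card_has_witnesses_ge[OF assms(3), of K] unfolding W_def by (simp add: field_simps)
  also have "\<dots> = measure P W" using W(2) by (simp add: card_perms)
  also have "\<dots> = measure (P \<Otimes>\<^sub>M U) (W \<times> space U)"
    using W(1) by (simp add: measure_def U.emeasure_pair_measure_Times U.emeasure_space_1)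
  also have "\<dots> \<le> measure (P \<Otimes>\<^sub>M U) {\<omega> \<in> space (P \<Otimes>\<^sub>M U). sparsest_fit_recovers n (rm_f K \<omega>)}"
  proof (rule PU.P.finite_measure_mono_AE)
    show "{\<omega> \<in> space (P \<Otimes>\<^sub>M U). sparsest_fit_recovers n (rm_f K \<omega>)} \<in> sets (P \<Otimes>\<^sub>M U)"
      using measurable_sparsest_fit_recovers[OF measurable_rm_f[of K _ n a b], of n]
      unfolding space pred_def .
    show "AE \<omega> in P \<Otimes>\<^sub>M U. \<omega> \<in> W \<times> space U \<longrightarrow>
        \<omega> \<in> {\<omega> \<in> space (P \<Otimes>\<^sub>M U). sparsest_fit_recovers n (rm_f K \<omega>)}"
      using AE AE_space
    proof eventually_elim
      case (elim \<omega>)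
      obtain s p where \<omega>: "\<omega> = (s, p)" by (cases \<omega>)
      have "sparsest_fit_recovers n (rm_f K (s, p))" if "s \<in> W"
      proof (rule sparsest_fit_recovers_rm_f)
        show "p k > 0" if "k < K" for k using elim(1) that assms(1) unfolding \<omega> by force
        show "s k \<in> perms n" if "k < K" for k using \<open>s \<in> W\<close> that WP by (auto intro: PiE_mem)
      qed (use that elim(1) in \<open>auto simp: W_def \<omega>\<close>)
      then show ?case using elim(2) unfolding \<omega> by auto
    qed
  qed
  finally show ?thesis unfolding space .
qed

section \<open>Analytic estimates and the limit\<close>

lemma exp_le_one_minus_inverse:
  fixes m :: real
  assumes "m > 1"
  shows "exp (- 1 / (m - 1)) \<le> 1 - 1 / m"
proof -
  \<comment> \<open>The point \<open>1 / (m - 1)\<close> is chosen because the left side is then the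
    inverse of \<open>1 - 1 / m\<close>.\<close>
  have "1 + 1 / (m - 1) \<le> exp (1 / (m - 1))" by (rule exp_ge_add_one_self)
  then have "inverse (exp (1 / (m - 1))) \<le> inverse (1 + 1 / (m - 1))"
    using assms by (intro le_imp_inverse_le) (auto intro: add_pos_pos)
  also have "\<dots> = 1 - 1 / m" using assms by (simp add: field_simps)
  finally show ?thesis by (simp add: exp_minus[symmetric])
qed

text \<open>The slack \<open>2 * e\<close> is spent in two halves: one pays for the shrinking of
  \<open>n\<close> to \<open>m\<close>, about \<open>(1 - e) * n\<close>; the other makes the
  witness probability of a column at least \<open>n powr (e - 1)\<close>, so that about
  \<open>e * n\<close> columns almost surely fail to fail together as \<open>n\<close>
  grows.\<close>

lemma witness_failure_bound:
  fixes e :: real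
  assumes e: "0 < e" "e \<le> 1/4" and K: "real K \<le> (1 - 2 * e) * real n * ln (real n)"
    and n: "e\<^sup>2 * real n \<ge> 1" and L: "L = nat \<lfloor>e * real n\<rfloor>"
  shows "real K * (1 - (1 - 1 / real (n - L)) ^ (K - 1)) ^ L
     \<le> real n * ln (real n) * exp (- ((e * real n - 1) * real n powr (e - 1)))"
proof -
  define m where "m = real (n - L)"
  define t where "t = real n powr (e - 1)"
  have "e\<^sup>2 \<le> (1/4)\<^sup>2" using e by (intro power_mono) auto
  then have "e\<^sup>2 * real n \<le> 1/16 * real n" by (intro mult_right_mono) (auto simp: power2_eq_square)
  then have n16: "real n \<ge> 16" using n by linarith
  have "0 \<le> e * real n" using e by simp
  then have Lr: "e * real n - 1 \<le> real L" "real L \<le> e * real n" unfolding L by linarith+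
  have "e * real n \<le> 1/4 * real n" using e by (intro mult_right_mono) auto
  then have "real L \<le> real n" using Lr by linarith
  then have m: "m = real n - real L" unfolding m_def by (simp add: of_nat_diff)
  have m1: "(1 - e) * real n - 1 \<le> m - 1" using Lr unfolding m by (simp add: algebra_simps)
  have "(1 - e) * real n \<ge> 3/4 * real n" using e by (intro mult_right_mono) auto
  then have pos: "(1 - e) * real n - 1 > 0" "m > 1" using n16 m1 by linarith+
  have lnn: "ln (real n) \<ge> 0" using n16 by simp
  have "real K \<le> (1 - 2 * e) * real n * ln (real n)" by (rule K)
  \<comment> \<open>The right factor exceeds \<open>(1 - 2 * e) * n\<close> by
    \<open>e\<^sup>2 * n - (1 - e)\<close>, which the assumption
    \<open>e\<^sup>2 * n \<ge> 1\<close> makes positive; it absorbs the rounding in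
    \<open>L\<close>.\<close>
  also have "\<dots> \<le> (1 - e) * ((1 - e) * real n - 1) * ln (real n)"
    using n e lnn by (intro mult_right_mono) (auto simp: algebra_simps power2_eq_square)
  also have "\<dots> \<le> (1 - e) * (m - 1) * ln (real n)"
    using m1 e lnn by (intro mult_right_mono mult_left_mono) auto
  finally have "real K / (m - 1) \<le> (1 - e) * ln (real n)"
    using pos by (simp add: field_simps)
  then have "t \<le> exp (real K * (- 1 / (m - 1)))"
    using n16 unfolding t_def powr_def by (auto simp: algebra_simps)
  also have "\<dots> = exp (- 1 / (m - 1)) ^ K" by (rule exp_of_nat_mult)
  also have "\<dots> \<le> (1 - 1 / m) ^ K"
    using pos by (intro power_mono exp_le_one_minus_inverse) auto
  also have "\<dots> \<le> (1 - 1 / m) ^ (K - 1)"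
    using pos by (intro power_decreasing) auto
  finally have "1 - (1 - 1 / m) ^ (K - 1) \<le> 1 - t" by simp
  also have "\<dots> \<le> exp (- t)" using exp_ge_add_one_self[of "- t"] by simp
  finally have le: "1 - (1 - 1 / m) ^ (K - 1) \<le> exp (- t)" .
  have "(1 - 1 / m) ^ (K - 1) \<le> 1" using pos by (intro power_le_one) auto
  then have "(1 - (1 - 1 / m) ^ (K - 1)) ^ L \<le> exp (- t) ^ L"
    using le by (intro power_mono) auto
  also have "\<dots> = exp (real L * (- t))" by (rule exp_of_nat_mult[symmetric])
  also have "\<dots> \<le> exp (- ((e * real n - 1) * t))"
    using mult_right_mono[OF Lr(1), of t] by (simp add: t_def)
  finally have "(1 - (1 - 1 / m) ^ (K - 1)) ^ L \<le> exp (- ((e * real n - 1) * t))" .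
  moreover have "real K \<le> real n * ln (real n)"
  proof -
    have "(1 - 2 * e) * (real n * ln (real n)) \<le> 1 * (real n * ln (real n))"
      using e lnn by (intro mult_right_mono) auto
    then show ?thesis using K by (simp add: mult.assoc)
  qed
  ultimately show ?thesis
    unfolding m_def[symmetric] t_def[symmetric]
    using \<open>(1 - 1 / m) ^ (K - 1) \<le> 1\<close> lnn by (intro mult_mono) auto
qed

theorem theorem3:
  fixes \<epsilon> a b :: real and K :: "nat \<Rightarrow> nat"
  assumes "\<epsilon> > 0" and "0 < a" and "a < b"
    and "\<And>n. real (K n) \<le> (1 - \<epsilon>) * real n * ln (real n)"
  shows "(\<lambda>n. measure (rm_space n (K n) a b)
            {\<omega> \<in> space (rm_space n (K n) a b). sparsest_fit_recovers n (rm_f (K n) \<omega>)})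
         \<longlonglongrightarrow> 1"
proof -
  \<comment> \<open>Half of \<epsilon> matches the \<open>1 - 2 * e\<close> of
    \<open>witness_failure_bound\<close>; the cap at 1/2 inside \<open>min\<close> gives
    \<open>e \<le> 1/4\<close>.\<close>
  define e where "e = min \<epsilon> (1/2) / 2"
  have e: "0 < e" "e \<le> 1/4" "2 * e \<le> \<epsilon>" using assms(1) unfolding e_def by auto
  define g where "g = (\<lambda>n::nat. real n * ln (real n) * exp (- ((e * real n - 1) * real n powr (e - 1))))"
  \<comment> \<open>The exponent grows in absolute value like \<open>e * n powr e\<close>, which
    beats the logarithm of the prefactor \<open>n * ln n\<close>.\<close>
  have g: "g \<longlonglongrightarrow> 0" unfolding g_def using e by real_asymp
  have "eventually (\<lambda>n::nat. e\<^sup>2 * real n \<ge> 1) sequentially" using e by real_asymp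
  then have lower: "eventually (\<lambda>n. 1 - g n \<le> measure (rm_space n (K n) a b)
      {\<omega> \<in> space (rm_space n (K n) a b). sparsest_fit_recovers n (rm_f (K n) \<omega>)}) sequentially"
  proof eventually_elim
    case (elim n)
    then have n: "n > 0" by (cases n) auto
    then have "(1 - \<epsilon>) * (real n * ln (real n)) \<le> (1 - 2 * e) * (real n * ln (real n))"
      using e by (intro mult_right_mono) auto
    then have K: "real (K n) \<le> (1 - 2 * e) * real n * ln (real n)"
      using assms(4)[of n] by (simp add: mult.assoc)
    have "e * real n < 1 * real n" using e n by (intro mult_strict_right_mono) auto
    then have "nat \<lfloor>e * real n\<rfloor> < n" using e n by linarith
    from measure_sparsest_fit_recovers_ge[OF assms(2,3) this, of "K n"]
      witness_failure_bound[OF e(1,2) K elim refl]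
    show ?case unfolding g_def by linarith
  qed
  have lim: "(\<lambda>n. 1 - g n) \<longlonglongrightarrow> 1" using tendsto_diff[OF tendsto_const g, of 1] by simp
  have prob: "prob_space (rm_space n (K n) a b)" for n
    unfolding rm_space_def
    by (intro prob_space_pair prob_space_PiM prob_space_measure_pmf prob_space_uniform_interval assms)
  show ?thesis
    by (rule tendsto_sandwich[OF lower _ lim tendsto_const]) (simp add: prob_space.prob_le_1[OF prob])
qed

end
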